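(* Suppose $U$ satisfies Assumption 1. Then there exists a constant $\alpha(U)>0$ such that for all $0<\alpha\le\alpha(U)$ there is a unique pair $(q,\psi)\in[0,1/25]\times[0,\infty)$ satisfying $$q=\mathbb E\big[\mathrm{th}(\psi^{1/2}Z)^2\big],\qquad \psi=\alpha\,\mathbb E\big[F_q(q^{1/2}Z)^2\big],$$ and this solution satisfies $$\frac{(\mathbb E_\xi[\xi U(\xi)])^2}{2}\le\frac q\alpha\le\frac\psi\alpha\le 3\,C_1(U)^2 .$$ Moreover (when $K_2(U)<\infty$) one can take $$\alpha(U)=\frac{1}{e^{10}\,c_1\,C_1(U)^6\,K_2(U)^4}.$$
   Context: $\xi,\xi',Z$ are independent standard Gaussian random variables, $\varphi$ is the standard Gaussian density, $\mathbb E_\xi$ is expectation over $\xi$ only, $\mathrm{th}=\tanh$. Assumption 1: $U:\mathbb R\to[0,1]$ is measurable and $\mathbb E_\xi[\xi U(\xi)]\ne0$. For $q\in[0,1)$: $L_q(x)=\log\mathbb E_\xi U(x+(1-q)^{1/2}\xi)$ and $F_q(x)=(L_q)'(x)=\frac{1}{(1-q)^{1/2}}\frac{\mathbb E_\xi[\xi U(x+(1-q)^{1/2}\xi)]}{\mathbb E_\xi U(x+(1-q)^{1/2}\xi)}$. $K_2(U)=\max\Big\{1,\sup\Big\{\frac{\mathbb E_{\xi,\xi'}[(\xi-\xi')^2U(x+c\xi)U(x+c\xi')]}{\mathbb E_{\xi,\xi'}[U(x+c\xi)U(x+c\xi')]}:x\in\mathbb R,\ \tfrac12\le c\le2\Big\}\Big\}$.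 Constants. $\bar c_1(U)=\max\{2,\sup\{1/\mathbb E_\xi U(c\xi):\frac12\le c\le2\}\}<\infty$, $K_0(U)=(8\log\bar c_1(U))^{1/2}$, and $C_1(U)=(4K_0(U))^{200}+c_0\,\bar c_1(U)\ge10$, where $c_0\ge5$ is a fixed absolute constant such that $\mathbb E(|\xi|^p;|\xi|\ge m)\le c_0\,\varphi(m/1.05)/(m/1.05)$ for all $m>0$, $0\le p\le200$. $c_1\ge1$ is a fixed absolute constant such that for every $U$ satisfying Assumption 1, $\sup_{0\le q\le1/2}|\frac{d}{dq}\mathbb E[F_q(q^{1/2}Z)^2]|\le c_1C_1(U)^6$ and $\sup_{0\le q\le1/2}|\frac{d}{dq}\mathbb E[L_q(q^{1/2}Z)]|\le c_1C_1(U)^2$. *)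

theory Defs
  imports "HOL-Probability.Probability"
begin

abbreviation gauss :: "real measure" where
  "gauss \<equiv> density lborel std_normal_density"

definition gauss_exp :: "(real \<Rightarrow> real) \<Rightarrow> real" where
  "gauss_exp f = (\<integral>x. f x \<partial>gauss)"

definition gauss_exp2 :: "(real \<Rightarrow> real \<Rightarrow> real) \<Rightarrow> real" where
  "gauss_exp2 f = (\<integral>z. f (fst z) (snd z) \<partial>(gauss \<Otimes>\<^sub>M gauss))"

definition assumption1 :: "(real \<Rightarrow> real) \<Rightarrow> bool" where
  "assumption1 U \<longleftrightarrow>
     U \<in> borel_measurable borel \<and> (\<forall>x. 0 \<le> U x \<and> U x \<le> 1) \<and>
     gauss_exp (\<lambda>\<xi>. \<xi> * U \<xi>) \<noteq> 0"

definition L :: "(real \<Rightarrow> real) \<Rightarrow> real \<Rightarrow> real \<Rightarrow> real" where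
  "L U q x = ln (gauss_exp (\<lambda>\<xi>. U (x + sqrt (1 - q) * \<xi>)))"

(* The derivative of L U q, for 0 \<le> q < 1, in the explicit form obtained by
   Gaussian integration by parts (U itself need not be differentiable). *)
definition F :: "(real \<Rightarrow> real) \<Rightarrow> real \<Rightarrow> real \<Rightarrow> real" where
  "F U q x = 1 / sqrt (1 - q) *
     (gauss_exp (\<lambda>\<xi>. \<xi> * U (x + sqrt (1 - q) * \<xi>)) /
      gauss_exp (\<lambda>\<xi>. U (x + sqrt (1 - q) * \<xi>)))"

(* The supremum may be infinite, hence the extended reals. *)
definition K2 :: "(real \<Rightarrow> real) \<Rightarrow> ereal" where
  "K2 U = max 1 (SUP (x, c) \<in> UNIV \<times> {1/2..2}.
     ereal (gauss_exp2 (\<lambda>\<xi> \<xi>'. (\<xi> - \<xi>')\<^sup>2 * U (x + c * \<xi>) * U (x + c * \<xi>')) /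
            gauss_exp2 (\<lambda>\<xi> \<xi>'. U (x + c * \<xi>) * U (x + c * \<xi>'))))"

(* For c in [1/2, 2] the density of c * \<xi> is at least a quarter of that of \<xi> / 2, so under
   assumption1 the expectation is bounded away from 0 and the set below is bounded above. *)
definition c1bar :: "(real \<Rightarrow> real) \<Rightarrow> real" where
  "c1bar U = max 2 (SUP c \<in> {1/2..2}. 1 / gauss_exp (\<lambda>\<xi>. U (c * \<xi>)))"

definition K0 :: "(real \<Rightarrow> real) \<Rightarrow> real" where
  "K0 U = sqrt (8 * ln (c1bar U))"

definition C1 :: "real \<Rightarrow> (real \<Rightarrow> real) \<Rightarrow> real" where
  "C1 c0 U = (4 * K0 U) ^ 200 + c0 * c1bar U"

definition c0_const :: "real \<Rightarrow> bool" where
  "c0_const c0 \<longleftrightarrow> c0 \<ge> 5 \<and>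
     (\<forall>m p. 0 < m \<and> 0 \<le> p \<and> p \<le> 200 \<longrightarrow>
        gauss_exp (\<lambda>\<xi>. \<bar>\<xi>\<bar> powr p * indicator {\<xi>. \<bar>\<xi>\<bar> \<ge> m} \<xi>)
          \<le> c0 * (std_normal_density (m / 1.05) / (m / 1.05)))"

(* L U q and F U q are meaningful for 0 \<le> q < 1 only, so the derivatives in q are taken
   within {0..<1}: two-sided for q > 0 and one-sided at q = 0. *)
definition c1_const :: "real \<Rightarrow> real \<Rightarrow> bool" where
  "c1_const c0 c1 \<longleftrightarrow> c1 \<ge> 1 \<and>
     (\<forall>U. assumption1 U \<longrightarrow> (\<forall>q\<in>{0..1/2}.
        (\<exists>D. ((\<lambda>q. gauss_exp (\<lambda>z. (F U q (sqrt q * z))\<^sup>2)) has_real_derivative D)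
               (at q within {0..<1}) \<and> \<bar>D\<bar> \<le> c1 * C1 c0 U ^ 6) \<and>
        (\<exists>D. ((\<lambda>q. gauss_exp (\<lambda>z. L U q (sqrt q * z))) has_real_derivative D)
               (at q within {0..<1}) \<and> \<bar>D\<bar> \<le> c1 * C1 c0 U ^ 2)))"

definition is_fixed_point :: "(real \<Rightarrow> real) \<Rightarrow> real \<Rightarrow> real \<times> real \<Rightarrow> bool" where
  "is_fixed_point U \<alpha> = (\<lambda>(q, \<psi>). q \<in> {0..1/25} \<and> \<psi> \<in> {0..} \<and>
     q = gauss_exp (\<lambda>z. (tanh (sqrt \<psi> * z))\<^sup>2) \<and>
     \<psi> = \<alpha> * gauss_exp (\<lambda>z. (F U q (sqrt q * z))\<^sup>2))"

definition admissible_threshold :: "real \<Rightarrow> (real \<Rightarrow> real) \<Rightarrow> real \<Rightarrow> bool" where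
  "admissible_threshold c0 U a \<longleftrightarrow> 0 < a \<and>
     (\<forall>\<alpha>. 0 < \<alpha> \<and> \<alpha> \<le> a \<longrightarrow>
        (\<exists>!s. is_fixed_point U \<alpha> s) \<and>
        (\<forall>q \<psi>. is_fixed_point U \<alpha> (q, \<psi>) \<longrightarrow>
           (gauss_exp (\<lambda>\<xi>. \<xi> * U \<xi>))\<^sup>2 / 2 \<le> q / \<alpha> \<and>
           q / \<alpha> \<le> \<psi> / \<alpha> \<and>
           \<psi> / \<alpha> \<le> 3 * (C1 c0 U)\<^sup>2))"

end

theory Submission
  imports Defs
begin

text \<open>
  Put \<open>G(q) = E[F\<^sub>q(\<surd>q Z)\<^sup>2]\<close> and \<open>P(\<psi>) = E[tanh(\<surd>\<psi> Z)\<^sup>2]\<close>. The system says \<open>q = P(\<alpha> G(q))\<close>,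
  with \<open>\<psi> = \<alpha> G(q)\<close> determined by \<open>q\<close>, so it is a fixed point equation in \<open>q\<close> alone.

  Since \<open>x\<^sup>2 - tanh(x)\<^sup>2\<close> is increasing for \<open>x \<ge> 0\<close>, the function \<open>P\<close> is 1-Lipschitz
  (\<open>tanh_moment_Lipschitz\<close>), and \<open>G\<close> is Lipschitz with constant \<open>M = c\<^sub>1 C\<^sub>1\<^sup>6\<close> by the defining
  property of \<open>c\<^sub>1\<close>. If \<open>\<alpha> M \<le> 1/1000\<close>, then \<open>q \<mapsto> P(\<alpha> G(q))\<close> is a contraction of \<open>[0,1/25]\<close>, and
  Banach's theorem gives existence and uniqueness (\<open>coupled_fixed_point_unique\<close>).

  At the fixed point \<open>q \<le> \<psi> = \<alpha> G(q)\<close>, so \<open>\<bar>G(q) - G(0)\<bar> \<le> M q \<le> G(q)/1000\<close>: the value \<open>\<psi>/\<alpha> = G(q)\<close> is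
  \<open>G(0) = (E[\<xi> U(\<xi>)] / E[U(\<xi>)])\<^sup>2\<close> up to a factor close to one. This number is at least
  \<open>E[\<xi> U(\<xi>)]\<^sup>2\<close> because \<open>U \<le> 1\<close>, and at most \<open>c1bar\<^sup>2 \<le> C\<^sub>1\<^sup>2\<close> because \<open>E\<bar>\<xi>\<bar> \<le> 1\<close>. Finally \<open>q\<close> and
  \<open>\<psi>\<close> differ by at most \<open>3 \<psi>\<^sup>2\<close> (\<open>tanh_moment_lower\<close>), which is small against \<open>\<psi>\<close>. As \<open>K\<^sub>2 \<ge> 1\<close>
  and \<open>e\<^sup>1\<^sup>0 \<ge> 1000\<close>, the threshold in the theorem satisfies the requirement \<open>\<alpha> M \<le> 1/1000\<close>.
\<close>

section \<open>Gaussian expectations\<close>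

lemma prob_space_gauss: "prob_space gauss"
  by (rule prob_space_normal_density) simp

lemma gauss_exp_const [simp]: "gauss_exp (\<lambda>_. c) = c"
  unfolding gauss_exp_def using prob_space.prob_space[OF prob_space_gauss] by simp

lemma gauss_exp_lborel:
  assumes "f \<in> borel_measurable borel"
  shows "gauss_exp f = (\<integral>x. std_normal_density x * f x \<partial>lborel)"
  unfolding gauss_exp_def using assms by (subst integral_density) auto

lemma integrable_gauss_lborel:
  fixes f :: "real \<Rightarrow> real"
  assumes "f \<in> borel_measurable borel"
  shows "integrable gauss f \<longleftrightarrow> integrable lborel (\<lambda>x. std_normal_density x * f x)"
  using assms by (subst integrable_density) auto

lemma integrable_gauss_bounded:
  fixes f :: "real \<Rightarrow> real"
  assumes "f \<in> borel_measurable borel" "\<And>x. \<bar>f x\<bar> \<le> B"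
  shows "integrable gauss f"
proof -
  interpret prob_space gauss by (rule prob_space_gauss)
  show ?thesis
    by (rule integrable_const_bound[where B = B]) (use assms in auto)
qed

lemma gauss_even_moment:
  shows "integrable gauss (\<lambda>x. x ^ (2 * k))"
    and "gauss_exp (\<lambda>x. x ^ (2 * k)) = fact (2 * k) / (2 ^ k * fact k)"
  using std_normal_moment_even[of k]
  by (auto simp: integrable_gauss_lborel gauss_exp_lborel has_bochner_integral_iff)

lemma gauss_second_moment: "integrable gauss (\<lambda>x. x\<^sup>2)" "gauss_exp (\<lambda>x. x\<^sup>2) = 1"
  using gauss_even_moment[of 1] by (simp_all add: fact_numeral)

lemma gauss_fourth_moment: "integrable gauss (\<lambda>x. x ^ 4)" "gauss_exp (\<lambda>x. x ^ 4) = 3"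
  using gauss_even_moment[of 2] by (simp_all add: fact_numeral)

section \<open>The second moment of tanh at a Gaussian\<close>

lemma tanh_le_self:
  fixes x :: real
  assumes "0 \<le> x"
  shows "tanh x \<le> x"
proof -
  have "\<exists>D. ((\<lambda>x. x - tanh x) has_real_derivative D) (at y) \<and> D \<ge> 0" for y :: real
    by (rule exI[of _ "(tanh y)\<^sup>2"]) (auto intro!: derivative_eq_intros)
  then have "0 - tanh 0 \<le> x - tanh x"
    using DERIV_nonneg_imp_nondecreasing[of 0 x "\<lambda>x. x - tanh x"] assms by blast
  then show ?thesis by simp
qed

text \<open>The derivative of \<open>x\<^sup>2 - tanh(x)\<^sup>2\<close> is \<open>2 (x - tanh x (1 - tanh(x)\<^sup>2)) \<ge> 2 (x - tanh x) \<ge> 0\<close>.\<close>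

lemma tanh_square_diff_le:
  fixes a b :: real
  assumes "0 \<le> a" "a \<le> b"
  shows "(tanh b)\<^sup>2 - (tanh a)\<^sup>2 \<le> b\<^sup>2 - a\<^sup>2"
proof -
  have "\<exists>D. ((\<lambda>x. x\<^sup>2 - (tanh x)\<^sup>2) has_real_derivative D) (at y) \<and> D \<ge> 0" if "a \<le> y" for y :: real
  proof (intro exI conjI)
    show "((\<lambda>x. x\<^sup>2 - (tanh x)\<^sup>2) has_real_derivative 2 * y - 2 * (tanh y * (1 - (tanh y)\<^sup>2))) (at y)"
      by (auto intro!: derivative_eq_intros)
    have "tanh y * (1 - (tanh y)\<^sup>2) \<le> tanh y * 1"
      using that assms by (intro mult_left_mono) auto
    then show "0 \<le> 2 * y - 2 * (tanh y * (1 - (tanh y)\<^sup>2))"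
      using tanh_le_self[of y] that assms by linarith
  qed
  then have "a\<^sup>2 - (tanh a)\<^sup>2 \<le> b\<^sup>2 - (tanh b)\<^sup>2"
    using DERIV_nonneg_imp_nondecreasing[of a b "\<lambda>x. x\<^sup>2 - (tanh x)\<^sup>2"] assms by blast
  then show ?thesis by simp
qed

text \<open>With \<open>s = sinh x\<close> one has \<open>tanh(x)\<^sup>2 = s\<^sup>2 / (1 + s\<^sup>2) \<ge> x\<^sup>2 / (1 + x\<^sup>2)\<close>, because
  \<open>\<bar>x\<bar> \<le> \<bar>s\<bar>\<close> and \<open>t / (1 + t)\<close> is increasing in \<open>t \<ge> 0\<close>; the last fraction is at least \<open>x\<^sup>2 - x\<^sup>4\<close>.\<close>

lemma tanh_square_ge:
  fixes x :: real
  shows "x\<^sup>2 - x ^ 4 \<le> (tanh x)\<^sup>2"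
proof -
  have pos: "y \<le> sinh y" if "0 \<le> y" for y :: real
  proof -
    have "\<exists>D. ((\<lambda>x. sinh x - x) has_real_derivative D) (at z) \<and> D \<ge> 0" for z :: real
      by (rule exI[of _ "cosh z - 1"])
        (auto intro!: derivative_eq_intros simp: cosh_real_ge_1)
    then have "sinh 0 - 0 \<le> sinh y - y"
      using DERIV_nonneg_imp_nondecreasing[of 0 y "\<lambda>x. sinh x - x"] that by blast
    then show ?thesis by simp
  qed
  have le: "x\<^sup>2 \<le> (sinh x)\<^sup>2"
  proof -
    have "\<bar>x\<bar> \<le> sinh \<bar>x\<bar>" by (rule pos) simp
    then have "\<bar>x\<bar>\<^sup>2 \<le> (sinh \<bar>x\<bar>)\<^sup>2" by (rule power_mono) simp
    then show ?thesis by (cases "x \<ge> 0") auto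
  qed
  have "(x\<^sup>2 - x ^ 4) * (1 + x\<^sup>2) \<le> x\<^sup>2"
    by (simp add: algebra_simps flip: power_add)
  then have "x\<^sup>2 - x ^ 4 \<le> x\<^sup>2 / (1 + x\<^sup>2)"
    by (subst pos_le_divide_eq) (auto simp: add_pos_nonneg)
  also have "\<dots> \<le> (sinh x)\<^sup>2 / (1 + (sinh x)\<^sup>2)"
  proof -
    have "x\<^sup>2 * (1 + (sinh x)\<^sup>2) \<le> (sinh x)\<^sup>2 * (1 + x\<^sup>2)"
      using le by (simp add: algebra_simps)
    then show ?thesis by (simp add: pos_divide_le_eq pos_le_divide_eq add_pos_nonneg)
  qed
  also have "\<dots> = (tanh x)\<^sup>2"
    by (simp add: tanh_def power_divide cosh_square_eq add.commute)
  finally show ?thesis .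
qed

definition tanh_moment :: "real \<Rightarrow> real" where
  "tanh_moment \<psi> = gauss_exp (\<lambda>z. (tanh (sqrt \<psi> * z))\<^sup>2)"

lemma borel_measurable_tanh [measurable]: "(tanh :: real \<Rightarrow> real) \<in> borel_measurable borel"
  by (intro borel_measurable_continuous_onI continuous_intros) auto

lemma integrable_tanh_square: "integrable gauss (\<lambda>z. (tanh (s * z))\<^sup>2)"
proof (rule integrable_gauss_bounded[where B = 1])
  show "\<bar>(tanh (s * x))\<^sup>2\<bar> \<le> 1" for x
    using tanh_real_bounds[of "s * x"] by (simp add: abs_square_le_1 abs_le_iff)
qed measurable

lemma tanh_moment_nonneg: "0 \<le> tanh_moment \<psi>"
  unfolding tanh_moment_def gauss_exp_def by (rule integral_nonneg_AE) simp

lemma tanh_moment_0 [simp]: "tanh_moment 0 = 0"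
  by (simp add: tanh_moment_def)

text \<open>Pointwise in \<open>z\<close>, the increment of \<open>tanh(\<surd>\<psi> z)\<^sup>2\<close> between \<open>\<psi> = a\<close> and \<open>\<psi> = b\<close> lies between \<open>0\<close> and
  \<open>(b - a) z\<^sup>2\<close>, and \<open>E[Z\<^sup>2] = 1\<close>.\<close>

lemma tanh_moment_increment:
  assumes "0 \<le> a" "a \<le> b"
  shows "0 \<le> tanh_moment b - tanh_moment a" and "tanh_moment b - tanh_moment a \<le> b - a"
proof -
  have abs: "(tanh (s * z))\<^sup>2 = (tanh (s * \<bar>z\<bar>))\<^sup>2" for s z :: real
    by (cases "z \<ge> 0") auto
  have diff: "tanh_moment b - tanh_moment a
      = (\<integral>z. (tanh (sqrt b * z))\<^sup>2 - (tanh (sqrt a * z))\<^sup>2 \<partial>gauss)"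
    unfolding tanh_moment_def gauss_exp_def
    by (rule Bochner_Integration.integral_diff[symmetric]) (rule integrable_tanh_square)+
  have "0 \<le> (tanh (sqrt b * z))\<^sup>2 - (tanh (sqrt a * z))\<^sup>2" for z
    unfolding abs[of _ z] using assms by (auto intro!: power_mono mult_right_mono)
  then show "0 \<le> tanh_moment b - tanh_moment a"
    unfolding diff by (intro integral_nonneg_AE) auto
  have "(tanh (sqrt b * z))\<^sup>2 - (tanh (sqrt a * z))\<^sup>2 \<le> (b - a) * z\<^sup>2" for z
    unfolding abs[of _ z]
    using tanh_square_diff_le[of "sqrt a * \<bar>z\<bar>" "sqrt b * \<bar>z\<bar>"] assms
    by (auto simp: power_mult_distrib mult_right_mono left_diff_distrib)
  then have "(\<integral>z. (tanh (sqrt b * z))\<^sup>2 - (tanh (sqrt a * z))\<^sup>2 \<partial>gauss) \<le> (\<integral>z. (b - a) * z\<^sup>2 \<partial>gauss)"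
    by (intro integral_mono Bochner_Integration.integrable_diff integrable_tanh_square
          integrable_mult_right gauss_second_moment) auto
  also have "\<dots> = b - a"
    using gauss_second_moment by (simp add: gauss_exp_def)
  finally show "tanh_moment b - tanh_moment a \<le> b - a" unfolding diff .
qed

lemma tanh_moment_Lipschitz:
  assumes "0 \<le> a" "0 \<le> b"
  shows "\<bar>tanh_moment a - tanh_moment b\<bar> \<le> \<bar>a - b\<bar>"
  using tanh_moment_increment[of a b] tanh_moment_increment[of b a] assms
  by (cases "a \<le> b") auto

lemma tanh_moment_le: "0 \<le> \<psi> \<Longrightarrow> tanh_moment \<psi> \<le> \<psi>"
  using tanh_moment_increment(2)[of 0 \<psi>] by simp

lemma tanh_moment_lower:
  assumes "0 \<le> \<psi>"
  shows "\<psi> - 3 * \<psi>\<^sup>2 \<le> tanh_moment \<psi>"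
proof -
  have "sqrt \<psi> ^ 4 = \<psi>\<^sup>2"
    using assms power_mult[of "sqrt \<psi>" 2 2] by simp
  then have "\<psi> * z\<^sup>2 - \<psi>\<^sup>2 * z ^ 4 \<le> (tanh (sqrt \<psi> * z))\<^sup>2" for z
    using tanh_square_ge[of "sqrt \<psi> * z"] assms by (simp add: power_mult_distrib)
  then have "(\<integral>z. \<psi> * z\<^sup>2 - \<psi>\<^sup>2 * z ^ 4 \<partial>gauss) \<le> tanh_moment \<psi>"
    unfolding tanh_moment_def gauss_exp_def
    by (intro integral_mono Bochner_Integration.integrable_diff integrable_tanh_square
          integrable_mult_right gauss_second_moment gauss_fourth_moment) auto
  also have "(\<integral>z. \<psi> * z\<^sup>2 - \<psi>\<^sup>2 * z ^ 4 \<partial>gauss) = \<psi> - 3 * \<psi>\<^sup>2"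
    using gauss_second_moment gauss_fourth_moment
    by (subst Bochner_Integration.integral_diff) (auto simp: gauss_exp_def)
  finally show ?thesis .
qed

section \<open>The coupled fixed point equation\<close>

lemma coupled_fixed_point_unique:
  fixes G P :: "real \<Rightarrow> real"
  assumes "0 < \<alpha>" and r: "0 < r"
    and G_nonneg: "\<And>q. 0 \<le> q \<Longrightarrow> q \<le> r \<Longrightarrow> 0 \<le> G q"
    and G_Lip: "\<And>x y. x \<in> {0..r} \<Longrightarrow> y \<in> {0..r} \<Longrightarrow> \<bar>G x - G y\<bar> \<le> M * \<bar>x - y\<bar>"
    and P_nonneg: "\<And>x. 0 \<le> P x"
    and P_le: "\<And>x. 0 \<le> x \<Longrightarrow> P x \<le> x"
    and P_Lip: "\<And>a b. 0 \<le> a \<Longrightarrow> 0 \<le> b \<Longrightarrow> \<bar>P a - P b\<bar> \<le> \<bar>a - b\<bar>"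
    and small: "0 \<le> M" "\<alpha> * M < 1" "\<alpha> * (G 0 + M * r) \<le> r"
  shows "\<exists>!q. q \<in> {0..r} \<and> P (\<alpha> * G q) = q"
proof -
  have self: "P (\<alpha> * G q) \<in> {0..r}" if "q \<in> {0..r}" for q
  proof -
    have "\<bar>G q - G 0\<bar> \<le> M * \<bar>q - 0\<bar>" using G_Lip[of q 0] that r by auto
    moreover have "M * \<bar>q - 0\<bar> \<le> M * r" using small that by (intro mult_left_mono) auto
    ultimately have "\<alpha> * G q \<le> \<alpha> * (G 0 + M * r)"
      using assms(1) by (intro mult_left_mono) auto
    moreover have "P (\<alpha> * G q) \<le> \<alpha> * G q"
      using P_le G_nonneg[of q] that assms(1) by auto
    ultimately show ?thesis using P_nonneg small by auto
  qed
  have contr: "dist (P (\<alpha> * G x)) (P (\<alpha> * G y)) \<le> (\<alpha> * M) * dist x y"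
    if "x \<in> {0..r}" "y \<in> {0..r}" for x y
  proof -
    have "\<bar>P (\<alpha> * G x) - P (\<alpha> * G y)\<bar> \<le> \<bar>\<alpha> * G x - \<alpha> * G y\<bar>"
      using P_Lip G_nonneg that assms(1) by auto
    also have "\<dots> = \<alpha> * \<bar>G x - G y\<bar>"
      using assms(1) by (simp add: abs_mult flip: right_diff_distrib)
    also have "\<dots> \<le> \<alpha> * (M * \<bar>x - y\<bar>)"
      using G_Lip that assms(1) by (intro mult_left_mono) auto
    finally show ?thesis by (simp add: dist_real_def mult.assoc)
  qed
  have "\<exists>!q\<in>{0..r}. P (\<alpha> * G q) = q"
    by (rule Banach_fix[where c = "\<alpha> * M"])
      (use self contr r small assms(1) in \<open>auto simp: complete_eq_closed\<close>)
  then show ?thesis .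
qed

section \<open>Bounds on U and its constants\<close>

text \<open>For \<open>c\<close> in \<open>[1/2, 2]\<close>, the density \<open>\<phi>(y/c)/c\<close> of \<open>c \<xi>\<close> is at least \<open>\<phi>(2y)/2\<close>. So the common
  lower bound is \<open>\<integral> \<phi>(2y) U(y) dy / 2\<close>; it could only vanish if \<open>U\<close> vanished almost everywhere,
  and then \<open>E[\<xi> U(\<xi>)]\<close> would be zero.\<close>

lemma expectation_U_bounded_below:
  assumes "assumption1 U"
  obtains m where "0 < m" "\<And>c. c \<in> {1/2..2} \<Longrightarrow> m \<le> gauss_exp (\<lambda>\<xi>. U (c * \<xi>))"
proof
  have U [measurable]: "U \<in> borel_measurable borel" and U01: "\<And>x. 0 \<le> U x" "\<And>x. U x \<le> 1"
    and ne: "gauss_exp (\<lambda>\<xi>. \<xi> * U \<xi>) \<noteq> 0"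
    using assms by (auto simp: assumption1_def)
  let ?g = "\<lambda>y. std_normal_density (2 * y) * U y / 2"
  have int_scaled: "integrable lborel (\<lambda>y. std_normal_density (y / c) * U y)" if "c > 0" for c
  proof -
    have "integrable gauss (\<lambda>x. U (c * x))"
    proof (rule integrable_gauss_bounded[where B = 1])
      show "\<bar>U (c * x)\<bar> \<le> 1" for x using U01[of "c * x"] by simp
    qed measurable
    then have "integrable lborel (\<lambda>x. std_normal_density x * U (c * x))"
      by (subst (asm) integrable_gauss_lborel) auto
    then have "integrable lborel (\<lambda>x. std_normal_density (0 + (1 / c) * x) * U (c * (0 + (1 / c) * x)))"
      by (rule lborel_integrable_real_affine) (use that in auto)
    then show ?thesis using that by simp
  qed
  have int_g: "integrable lborel ?g"
    using int_scaled[of "1/2"] by (simp add: mult.commute)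
  show "0 < (\<integral>y. ?g y \<partial>lborel)"
  proof (rule ccontr)
    assume "\<not> ?thesis"
    moreover have g0: "0 \<le> ?g y" for y using U01 by simp
    ultimately have "(\<integral>y. ?g y \<partial>lborel) = 0"
      by (smt (verit) Bochner_Integration.integral_nonneg)
    then have "AE y in lborel. ?g y = 0"
      using integral_nonneg_eq_0_iff_AE[OF int_g] g0 by auto
    moreover have pos: "std_normal_density y \<noteq> 0" for y
      using normal_density_pos[of 1 0 y] by simp
    ultimately have "AE y in lborel. std_normal_density y * (y * U y) = 0"
      by (auto elim!: eventually_mono)
    then have "(\<integral>y. std_normal_density y * (y * U y) \<partial>lborel) = 0"
      by (rule integral_eq_zero_AE)
    then show False using ne by (subst (asm) gauss_exp_lborel) auto
  qed
  show "(\<integral>y. ?g y \<partial>lborel) \<le> gauss_exp (\<lambda>\<xi>. U (c * \<xi>))" if c: "c \<in> {1/2..2}" for c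
  proof -
    have "gauss_exp (\<lambda>\<xi>. U (c * \<xi>)) = (\<integral>x. std_normal_density x * U (c * x) \<partial>lborel)"
      by (rule gauss_exp_lborel) measurable
    also have "\<dots> = \<bar>1 / c\<bar> *\<^sub>R (\<integral>y. std_normal_density (0 + 1 / c * y) * U (c * (0 + 1 / c * y)) \<partial>lborel)"
      by (rule lborel_integral_real_affine) (use c in auto)
    also have "\<dots> = (\<integral>y. (1 / c) * (std_normal_density (y / c) * U y) \<partial>lborel)"
      using c by simp
    also have "\<dots> \<ge> (\<integral>y. ?g y \<partial>lborel)"
    proof (rule integral_mono[OF int_g])
      show "integrable lborel (\<lambda>y. (1 / c) * (std_normal_density (y / c) * U y))"
        using int_scaled[of c] c by (intro integrable_mult_right) auto
      fix y :: real
      have "(y / c)\<^sup>2 \<le> (2 * y)\<^sup>2"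
      proof -
        have "\<bar>y / c\<bar> \<le> \<bar>2 * y\<bar>"
          using c mult_left_mono[of 1 "2 * c" "\<bar>y\<bar>"] by (simp add: abs_mult field_simps)
        then show ?thesis by (simp only: abs_le_square_iff)
      qed
      then have "std_normal_density (2 * y) \<le> std_normal_density (y / c)"
        by (simp add: normal_density_def divide_right_mono)
      then have "1 / 2 * (std_normal_density (2 * y) * U y) \<le> (1 / c) * (std_normal_density (y / c) * U y)"
        using c U01[of y] by (intro mult_mono) (auto simp: field_simps)
      then show "?g y \<le> (1 / c) * (std_normal_density (y / c) * U y)" by simp
    qed
    finally show ?thesis .
  qed
qed

lemma expectation_U_bounds:
  assumes "assumption1 U"
  shows "0 < gauss_exp U" "gauss_exp U \<le> 1" "1 / gauss_exp U \<le> c1bar U"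
proof -
  obtain m where m: "0 < m" "\<And>c. c \<in> {1/2..2} \<Longrightarrow> m \<le> gauss_exp (\<lambda>\<xi>. U (c * \<xi>))"
    using expectation_U_bounded_below[OF assms] by blast
  show "0 < gauss_exp U" using m(1) m(2)[of 1] by simp
  have "bdd_above ((\<lambda>c. 1 / gauss_exp (\<lambda>\<xi>. U (c * \<xi>))) ` {1/2..2})"
    by (rule bdd_aboveI[where M = "1 / m"]) (use m in \<open>force intro!: divide_left_mono mult_pos_pos\<close>)
  then have "1 / gauss_exp (\<lambda>\<xi>. U (1 * \<xi>)) \<le> (SUP c \<in> {1/2..2}. 1 / gauss_exp (\<lambda>\<xi>. U (c * \<xi>)))"
    by (rule cSUP_upper[rotated]) simp
  then show "1 / gauss_exp U \<le> c1bar U" by (simp add: c1bar_def)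
  have U: "U \<in> borel_measurable borel" "\<And>x. 0 \<le> U x" "\<And>x. U x \<le> 1"
    using assms by (auto simp: assumption1_def)
  have "integrable gauss U"
    by (rule integrable_gauss_bounded[where B = 1]) (use U in auto)
  then have "gauss_exp U \<le> gauss_exp (\<lambda>_. 1)"
    unfolding gauss_exp_def using U prob_space_gauss
    by (intro integral_mono) (auto intro!: integrable_gauss_bounded)
  then show "gauss_exp U \<le> 1" by simp
qed

text \<open>Here \<open>\<bar>\<xi> U(\<xi>)\<bar> \<le> \<bar>\<xi>\<bar> \<le> (1 + \<xi>\<^sup>2) / 2\<close>, and the right-hand side has expectation one.\<close>

lemma first_moment_U_le_1:
  assumes "assumption1 U"
  shows "(gauss_exp (\<lambda>\<xi>. \<xi> * U \<xi>))\<^sup>2 \<le> 1"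
proof -
  have [measurable]: "U \<in> borel_measurable borel" and U: "\<And>x. 0 \<le> U x" "\<And>x. U x \<le> 1"
    using assms by (auto simp: assumption1_def)
  have one: "integrable gauss (\<lambda>_. 1 :: real)"
    by (rule integrable_gauss_bounded[where B = 1]) auto
  have int: "integrable gauss (\<lambda>x. (1 + x\<^sup>2) / 2)"
    using one gauss_second_moment(1)
    by (intro integrable_divide Bochner_Integration.integrable_add)
  have bound: "\<bar>x * U x\<bar> \<le> (1 + x\<^sup>2) / 2" for x
  proof -
    have "\<bar>x * U x\<bar> \<le> \<bar>x\<bar> * 1"
      unfolding abs_mult using U[of x] by (intro mult_left_mono) auto
    moreover have "0 \<le> (\<bar>x\<bar> - 1)\<^sup>2" by simp
    ultimately show ?thesis by (simp add: power2_diff)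
  qed
  have "integrable gauss (\<lambda>x. x * U x)"
    by (rule Bochner_Integration.integrable_bound[OF int])
      (use bound in \<open>auto intro!: AE_I2 simp: order_trans[OF bound]\<close>)
  then have "\<bar>gauss_exp (\<lambda>\<xi>. \<xi> * U \<xi>)\<bar> \<le> (\<integral>x. (1 + x\<^sup>2) / 2 \<partial>gauss)"
    unfolding gauss_exp_def by (rule integral_abs_bound_integral[OF _ int]) (rule bound)
  also have "\<dots> = 1"
    using one gauss_second_moment prob_space.prob_space[OF prob_space_gauss]
    by (simp add: gauss_exp_def)
  finally show ?thesis by (simp add: abs_square_le_1)
qed

definition F_moment :: "(real \<Rightarrow> real) \<Rightarrow> real \<Rightarrow> real" where
  "F_moment U q = gauss_exp (\<lambda>z. (F U q (sqrt q * z))\<^sup>2)"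

lemma F_moment_nonneg: "0 \<le> F_moment U q"
  unfolding F_moment_def gauss_exp_def by (rule integral_nonneg_AE) simp

lemma F_moment_0: "F_moment U 0 = (gauss_exp (\<lambda>\<xi>. \<xi> * U \<xi>))\<^sup>2 / (gauss_exp U)\<^sup>2"
  by (simp add: F_moment_def F_def power_divide)

lemma F_moment_0_bounds:
  assumes "assumption1 U"
  shows "(gauss_exp (\<lambda>\<xi>. \<xi> * U \<xi>))\<^sup>2 \<le> F_moment U 0" "F_moment U 0 \<le> (c1bar U)\<^sup>2"
proof -
  note E = expectation_U_bounds[OF assms]
  have "(gauss_exp U)\<^sup>2 \<le> 1" using E by (simp add: abs_square_le_1)
  then have "(gauss_exp (\<lambda>\<xi>. \<xi> * U \<xi>))\<^sup>2 * (gauss_exp U)\<^sup>2 \<le> (gauss_exp (\<lambda>\<xi>. \<xi> * U \<xi>))\<^sup>2 * 1"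
    by (intro mult_left_mono) auto
  then show "(gauss_exp (\<lambda>\<xi>. \<xi> * U \<xi>))\<^sup>2 \<le> F_moment U 0"
    unfolding F_moment_0 using E by (simp add: pos_le_divide_eq)
  have "F_moment U 0 \<le> 1 / (gauss_exp U)\<^sup>2"
    unfolding F_moment_0 by (intro divide_right_mono first_moment_U_le_1 assms) simp
  also have "\<dots> = (1 / gauss_exp U)\<^sup>2" by (simp add: power_divide)
  also have "\<dots> \<le> (c1bar U)\<^sup>2" using E by (intro power_mono) auto
  finally show "F_moment U 0 \<le> (c1bar U)\<^sup>2" .
qed

lemma F_moment_Lipschitz:
  assumes "c1_const c0 c1" "assumption1 U" "x \<in> {0..1/2}" "y \<in> {0..1/2}"
  shows "\<bar>F_moment U x - F_moment U y\<bar> \<le> c1 * C1 c0 U ^ 6 * \<bar>x - y\<bar>"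
proof -
  have "\<forall>q\<in>{0..1/2}. \<exists>D. (F_moment U has_real_derivative D) (at q within {0..<1})
      \<and> \<bar>D\<bar> \<le> c1 * C1 c0 U ^ 6"
    using assms(1,2) unfolding c1_const_def F_moment_def[abs_def] by blast
  then obtain D where D: "\<And>q. q \<in> {0..1/2} \<Longrightarrow> (F_moment U has_real_derivative D q) (at q within {0..<1})"
      "\<And>q. q \<in> {0..1/2} \<Longrightarrow> \<bar>D q\<bar> \<le> c1 * C1 c0 U ^ 6"
    by metis
  have "norm (F_moment U x - F_moment U y) \<le> c1 * C1 c0 U ^ 6 * norm (x - y)"
  proof (rule field_differentiable_bound[of "{0..1/2}" _ D])
    show "(F_moment U has_real_derivative D q) (at q within {0..1/2})" if "q \<in> {0..1/2}" for q
      by (rule has_field_derivative_subset[OF D(1)[OF that]]) auto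
  qed (use assms D in auto)
  then show ?thesis by simp
qed

lemma C1_bounds:
  assumes "c0_const c0"
  shows "10 \<le> C1 c0 U" "c1bar U \<le> C1 c0 U"
proof -
  have c: "2 \<le> c1bar U" by (simp add: c1bar_def)
  have "5 * c1bar U \<le> c0 * c1bar U"
    using assms c by (intro mult_right_mono) (auto simp: c0_const_def)
  moreover have "0 \<le> (4 * K0 U) ^ 200" by (rule zero_le_even_power) simp
  ultimately have "5 * c1bar U \<le> C1 c0 U" unfolding C1_def by linarith
  then show "10 \<le> C1 c0 U" "c1bar U \<le> C1 c0 U" using c by auto
qed

section \<open>Admissible thresholds\<close>

lemma is_fixed_point_iff:
  "is_fixed_point U \<alpha> (q, \<psi>) \<longleftrightarrow>
     q \<in> {0..1/25} \<and> 0 \<le> \<psi> \<and> tanh_moment \<psi> = q \<and> \<psi> = \<alpha> * F_moment U q"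
  by (auto simp: is_fixed_point_def tanh_moment_def F_moment_def)

text \<open>The Lipschitz constant \<open>c\<^sub>1 C\<^sub>1\<^sup>6\<close> of \<open>G\<close> also dominates \<open>G(0) \<le> C\<^sub>1\<^sup>2\<close>. So the one smallness
  assumption makes \<open>q \<mapsto> P(\<alpha> G(q))\<close> a contraction, keeps it inside \<open>[0,1/25]\<close>, and forces \<open>\<psi>\<close> to be so
  small that \<open>P(\<psi>)\<close> is within three percent of \<open>\<psi>\<close>.\<close>

lemma admissible_threshold_if_small:
  assumes "c0_const c0" "c1_const c0 c1" "assumption1 U"
    and a: "0 < a" "a * (c1 * C1 c0 U ^ 6) \<le> 1 / 1000"
  shows "admissible_threshold c0 U a"
  unfolding admissible_threshold_def
proof (intro conjI allI impI a(1))
  define M where "M = c1 * C1 c0 U ^ 6"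
  define G where "G = F_moment U"
  have C: "10 \<le> C1 c0 U" and c1: "1 \<le> c1"
    using C1_bounds assms by (auto simp: c1_const_def)
  have "C1 c0 U ^ 2 \<le> C1 c0 U ^ 6" using C by (intro power_increasing) auto
  also have "\<dots> \<le> M" unfolding M_def using c1 C mult_right_mono[of 1 c1 "C1 c0 U ^ 6"] by simp
  finally have C_le_M: "(C1 c0 U)\<^sup>2 \<le> M" .
  then have M0: "0 \<le> M" by (smt (verit) zero_le_power2)
  have "(c1bar U)\<^sup>2 \<le> (C1 c0 U)\<^sup>2"
    using C1_bounds(2)[OF assms(1), of U] by (intro power_mono) (auto simp: c1bar_def)
  then have G0: "(gauss_exp (\<lambda>\<xi>. \<xi> * U \<xi>))\<^sup>2 \<le> G 0" "G 0 \<le> (C1 c0 U)\<^sup>2"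
    using F_moment_0_bounds[OF assms(3)] by (auto simp: G_def)
  have G_nonneg: "0 \<le> G q" for q by (simp add: G_def F_moment_nonneg)
  have G_Lip: "\<bar>G x - G y\<bar> \<le> M * \<bar>x - y\<bar>" if "x \<in> {0..1/25}" "y \<in> {0..1/25}" for x y
    unfolding G_def M_def using that by (intro F_moment_Lipschitz assms) auto
  fix \<alpha> assume \<alpha>: "0 < \<alpha> \<and> \<alpha> \<le> a"
  have "\<alpha> * M \<le> a * M" using \<alpha> M0 by (intro mult_right_mono) auto
  then have \<alpha>M: "\<alpha> * M \<le> 1 / 1000" using a by (simp add: M_def)
  have "\<alpha> * G 0 \<le> \<alpha> * M" using G0 C_le_M \<alpha> by (intro mult_left_mono) auto
  then have \<alpha>G0: "\<alpha> * G 0 \<le> 1 / 1000" using \<alpha>M by simp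
  have "\<exists>!q. q \<in> {0..1/25} \<and> tanh_moment (\<alpha> * G q) = q"
  proof (rule coupled_fixed_point_unique[where M = M])
    show "\<alpha> * (G 0 + M * (1/25)) \<le> 1/25" using \<alpha>M \<alpha>G0 by (simp add: algebra_simps)
  qed (use \<alpha> \<alpha>M M0 G_nonneg G_Lip tanh_moment_nonneg tanh_moment_le tanh_moment_Lipschitz in auto)
  then obtain q where q: "q \<in> {0..1/25}" "tanh_moment (\<alpha> * G q) = q"
    and uniq: "\<And>q'. q' \<in> {0..1/25} \<Longrightarrow> tanh_moment (\<alpha> * G q') = q' \<Longrightarrow> q' = q"
    by blast
  show "\<exists>!s. is_fixed_point U \<alpha> s"
  proof (rule ex1I[of _ "(q, \<alpha> * G q)"])
    show "is_fixed_point U \<alpha> (q, \<alpha> * G q)"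
      using q \<alpha> G_nonneg by (auto simp: is_fixed_point_iff G_def)
    show "s = (q, \<alpha> * G q)" if "is_fixed_point U \<alpha> s" for s
    proof (cases s)
      case (Pair q' \<psi>')
      from that have *: "q' \<in> {0..1/25}" "tanh_moment \<psi>' = q'" "\<psi>' = \<alpha> * G q'"
        unfolding Pair is_fixed_point_iff G_def by blast+
      have "q' = q" by (rule uniq[OF *(1)]) (use *(2) in \<open>simp only: *(3)\<close>)
      then show ?thesis using * Pair by simp
    qed
  qed
  fix q \<psi> assume "is_fixed_point U \<alpha> (q, \<psi>)"
  then have q: "q \<in> {0..1/25}" and \<psi>: "0 \<le> \<psi>" and q_eq: "tanh_moment \<psi> = q" and \<psi>_eq: "\<psi> = \<alpha> * G q"
    unfolding is_fixed_point_iff G_def by blast+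
  have q_le: "q \<le> \<psi>" using tanh_moment_le[OF \<psi>] unfolding q_eq .
  then show "q / \<alpha> \<le> \<psi> / \<alpha>" using \<alpha> by (intro divide_right_mono) auto
  have G_eq: "\<psi> / \<alpha> = G q" using \<psi>_eq \<alpha> by simp
  \<comment> \<open>Since \<open>M q \<le> M \<psi> = (\<alpha> M) G(q)\<close>, the error is relative to \<open>G(q)\<close> itself.\<close>
  have close: "\<bar>G q - G 0\<bar> \<le> G q / 1000"
  proof -
    have "\<bar>G q - G 0\<bar> \<le> M * q" using G_Lip[of q 0] q by simp
    also have "\<dots> \<le> M * \<psi>" using q_le M0 by (intro mult_left_mono) auto
    also have "\<dots> = (\<alpha> * M) * G q" using \<psi>_eq by simp
    also have "\<dots> \<le> (1 / 1000) * G q" using \<alpha>M G_nonneg by (intro mult_right_mono) auto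
    finally show ?thesis by simp
  qed
  then show "\<psi> / \<alpha> \<le> 3 * (C1 c0 U)\<^sup>2"
    using G0 G_nonneg[of q] G_nonneg[of 0] unfolding G_eq by linarith
  have "G q \<le> 2 * G 0" using close G_nonneg[of q] by linarith
  then have "\<psi> \<le> \<alpha> * (2 * G 0)" unfolding \<psi>_eq using \<alpha> by (intro mult_left_mono) auto
  then have \<psi>_small: "\<psi> \<le> 1 / 100" using \<alpha>G0 by simp
  have "3 * \<psi>\<^sup>2 \<le> 3 * (1 / 100 * \<psi>)"
    unfolding power2_eq_square using \<psi>_small \<psi> by (intro mult_left_mono mult_right_mono) auto
  then have "97 / 100 * \<psi> \<le> q" using tanh_moment_lower[OF \<psi>] q_eq by linarith
  then have "97 / 100 * \<psi> / \<alpha> \<le> q / \<alpha>" using \<alpha> by (intro divide_right_mono) auto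
  then have "97 / 100 * G q \<le> q / \<alpha>" using G_eq by (metis times_divide_eq_right)
  then show "(gauss_exp (\<lambda>\<xi>. \<xi> * U \<xi>))\<^sup>2 / 2 \<le> q / \<alpha>"
    using close G0 G_nonneg[of q] G_nonneg[of 0] by linarith
qed

theorem proposition1p1:
  fixes c0 c1 :: real and U :: "real \<Rightarrow> real"
  assumes "c0_const c0"
    and "c1_const c0 c1"
    and "assumption1 U"
  shows "(\<exists>a. admissible_threshold c0 U a) \<and>
    (K2 U < \<infinity> \<longrightarrow>
       admissible_threshold c0 U
         (1 / (exp 10 * c1 * C1 c0 U ^ 6 * real_of_ereal (K2 U) ^ 4)))"
proof -
  define M where "M = c1 * C1 c0 U ^ 6"
  have "1 \<le> c1" "0 < C1 c0 U"
    using assms C1_bounds(1)[OF assms(1), of U] by (auto simp: c1_const_def)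
  then have M: "0 < M" by (simp add: M_def)
  have "(2::real) ^ 10 \<le> exp 1 ^ 10"
    using exp_ge_add_one_self[of 1] by (intro power_mono) auto
  also have "exp 1 ^ 10 = exp (10::real)" using exp_of_nat_mult[of 10 "1 :: real"] by simp
  finally have e: "1000 \<le> exp (10::real)" by simp
  have adm: "admissible_threshold c0 U (1 / (exp 10 * c1 * C1 c0 U ^ 6 * k ^ 4))" if "1 \<le> k" for k
  proof (rule admissible_threshold_if_small[OF assms])
    have eq: "exp 10 * c1 * C1 c0 U ^ 6 * k ^ 4 = M * (exp 10 * k ^ 4)" by (simp add: M_def)
    have "1000 * 1 \<le> exp 10 * k ^ 4" using e that by (intro mult_mono) auto
    then show "1 / (exp 10 * c1 * C1 c0 U ^ 6 * k ^ 4) * (c1 * C1 c0 U ^ 6) \<le> 1 / 1000"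
      unfolding eq M_def[symmetric] using M that by (simp add: field_simps)
    show "0 < 1 / (exp 10 * c1 * C1 c0 U ^ 6 * k ^ 4)"
      unfolding eq using M that by simp
  qed
  have "1 \<le> real_of_ereal (K2 U)" if "K2 U < \<infinity>"
  proof -
    have "1 \<le> K2 U" by (simp add: K2_def)
    then show ?thesis using that by (cases "K2 U") auto
  qed
  then show ?thesis using adm adm[of 1] by blast
qed

end
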